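(* Let $N,n,k$ be positive integers. For every ground state wave function $\phi\in\mathfrak W(\mathcal H_N(n,k)_0)$, $\phi$ solves the Knizhnik-Zamolodchikov equation $$(k+n)\,\partial_i\phi-\sum_{j\ne i}\frac{\Omega_{ij}+k}{x_i-x_j}\,\phi=0,\qquad \forall i\in\{1,\dots,N\},$$ where $\partial_i=\partial/\partial x_i$.
   Context: Let $\mathbb C[X,A]$ be the polynomial ring in the entries of an $N\times N$ matrix $X=(X^i_j)$ and an $n\times N$ matrix $A=(A^a_i)$, and $$\mathcal H_N(n,k)=\{f\in\mathbb C[X,A]: f(gXg^{-1},Ag^{-1})=\det(g)^{-k}f(X,A)\ \forall g\in GL_N(\mathbb C)\},$$ graded by $\deg X=1$, $\deg A=0$. $\mathcal H_N(n,k)_0$ is the homogeneous subspace of lowest degree occurring in $\mathcal H_N(n,k)$. The wave function map $\mathfrak W:\mathcal H_N(n,k)\hookrightarrow\mathbb C[\mathbb A^N_{\mathrm{disj}}]\otimes(S^k\mathbb C^n)^{\otimes N}$ sends $f$ to $$f(\mathrm{diag}(x_1,\dots,x_N),(y^a_i)),$$ where $x_1,\dots,x_N$ are the coordinates on $\mathbb A^N$, $\mathbb A^N_{\mathrm{disj}}=\{x_i\ne x_j\ \forall i\neq j\}$, and the $i$-th factor $S^k\mathbb C^n$ is the space of homogeneous polynomials of degree $k$ in $y^1_i,\dots,y^n_i$. On the $i$-th factor $\mathfrak{gl}_n$ acts by $E^a_{b,i}=y^a_i\,\partial/\partial y^b_i$, and $\Omega_{ij}=\sum_{a,b=1}^nE^a_{b,i}E^b_{a,j}$.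 *)

theory Defs
  imports "HOL-Analysis.Analysis" "HOL-Library.Poly_Mapping"
begin

text \<open>
  The types \<open>'N\<close> and \<open>'n\<close> are the index sets \<open>{1..N}\<close> and \<open>{1..n}\<close>, so \<open>N = CARD('N)\<close> and
  \<open>n = CARD('n)\<close>. An \<open>N \<times> N\<close> matrix has type \<^typ>\<open>complex^'N^'N\<close>, an \<open>n \<times> N\<close> matrix has type
  \<^typ>\<open>complex^'N^'n\<close>, and \<open>A $ a $ i\<close> is the entry in row \<open>a\<close> and column \<open>i\<close>.
\<close>

datatype ('N, 'n) entry = EntryX 'N 'N | EntryA 'n 'N

text \<open>Multivariate polynomials: finitely supported coefficient functions on monomials, which are
  in turn finitely supported exponent functions.\<close>

type_synonym ('N, 'n) matrix_poly = "(('N, 'n) entry \<Rightarrow>\<^sub>0 nat) \<Rightarrow>\<^sub>0 complex"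

fun entry_value :: "complex^'N^'N \<Rightarrow> complex^'N^'n \<Rightarrow> ('N, 'n) entry \<Rightarrow> complex" where
  "entry_value X A (EntryX i j) = X $ i $ j"
| "entry_value X A (EntryA a i) = A $ a $ i"

definition poly_value ::
    "('N, 'n) matrix_poly \<Rightarrow> complex^'N^'N \<Rightarrow> complex^'N^'n \<Rightarrow> complex" where
  "poly_value f X A =
     (\<Sum>m\<in>Poly_Mapping.keys f. Poly_Mapping.lookup f m *
        (\<Prod>v\<in>Poly_Mapping.keys m. entry_value X A v ^ Poly_Mapping.lookup m v))"

definition monom_deg_X :: "(('N::finite, 'n) entry \<Rightarrow>\<^sub>0 nat) \<Rightarrow> nat" where
  "monom_deg_X m = (\<Sum>i\<in>UNIV. \<Sum>j\<in>UNIV. Poly_Mapping.lookup m (EntryX i j))"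

definition homogeneous_X :: "nat \<Rightarrow> ('N::finite, 'n) matrix_poly \<Rightarrow> bool" where
  "homogeneous_X d f \<longleftrightarrow> (\<forall>m\<in>Poly_Mapping.keys f. monom_deg_X m = d)"

definition HN :: "nat \<Rightarrow> ('N::finite, 'n::finite) matrix_poly set" where
  "HN k = {f. \<forall>g :: complex^'N^'N. invertible g \<longrightarrow>
     (\<forall>X A. poly_value f (g ** X ** matrix_inv g) (A ** matrix_inv g) =
            det g powi (- int k) * poly_value f X A)}"

text \<open>The space \<open>HN k\<close> is a graded subspace, since the action of \<open>GL\<^sub>N\<close> preserves the degree in \<open>X\<close>;
  a degree occurs in it iff the corresponding homogeneous piece is nonzero.\<close>

definition HN0 :: "nat \<Rightarrow> ('N::finite, 'n::finite) matrix_poly set" where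
  "HN0 k = {f \<in> HN k. homogeneous_X
     (LEAST d. \<exists>h \<in> (HN k :: ('N, 'n) matrix_poly set). h \<noteq> 0 \<and> homogeneous_X d h) f}"

definition A_disj :: "(complex^'N) set" where
  "A_disj = {x. \<forall>i j. i \<noteq> j \<longrightarrow> x $ i \<noteq> x $ j}"

definition diag :: "complex^'N \<Rightarrow> complex^'N^'N" where
  "diag x = (\<chi> i j. if i = j then x $ i else 0)"

text \<open>An element of \<open>\<complex>[A_disj] \<otimes> (S\<^sup>k \<complex>\<^sup>n)\<^sup>\<otimes>\<^sup>N\<close> is represented by the function of \<open>x\<close> and of the
  variables \<open>y $ a $ i\<close> that it defines, where column \<open>i\<close> of \<open>y\<close> holds the variables of the \<open>i\<close>-th
  tensor factor. Only the values at points \<open>x \<in> A_disj\<close>, an open set, are meaningful.\<close>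

type_synonym ('N, 'n) wave = "complex^'N \<Rightarrow> complex^'N^'n \<Rightarrow> complex"

definition wave_function :: "('N::finite, 'n::finite) matrix_poly \<Rightarrow> ('N, 'n) wave" where
  "wave_function f = (\<lambda>x y. poly_value f (diag x) y)"

definition d_x :: "'N::finite \<Rightarrow> ('N, 'n::finite) wave \<Rightarrow> ('N, 'n) wave" where
  "d_x i \<phi> = (\<lambda>x y. deriv (\<lambda>t. \<phi> (\<chi> j. if j = i then t else x $ j) y) (x $ i))"

definition d_y :: "'n::finite \<Rightarrow> 'N::finite \<Rightarrow> ('N, 'n) wave \<Rightarrow> ('N, 'n) wave" where
  "d_y b i \<phi> = (\<lambda>x y.
     deriv (\<lambda>t. \<phi> x (\<chi> c j. if c = b \<and> j = i then t else y $ c $ j)) (y $ b $ i))"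

definition E_op :: "'n::finite \<Rightarrow> 'n \<Rightarrow> 'N::finite \<Rightarrow> ('N, 'n) wave \<Rightarrow> ('N, 'n) wave" where
  "E_op a b i \<phi> = (\<lambda>x y. y $ a $ i * d_y b i \<phi> x y)"

definition Omega :: "'N::finite \<Rightarrow> 'N \<Rightarrow> ('N, 'n::finite) wave \<Rightarrow> ('N, 'n) wave" where
  "Omega i j \<phi> = (\<lambda>x y. \<Sum>a\<in>UNIV. \<Sum>b\<in>UNIV. E_op a b i (E_op b a j \<phi>) x y)"

end

theory Submission
  imports Defs "HOL-Computational_Algebra.Polynomial"
begin

text \<open>
  Let \<open>D\<close> be the sum of the exponents \<open>p\<close> over the \<open>N\<close> lowest pairs \<open>(p, a)\<close>, and let \<open>G(X, A)\<close> be the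
  matrix with the corresponding rows \<open>A\<^sup>a X\<^sup>p\<close>. Since \<open>det (G)\<^sup>k\<close> is covariant, a ground state \<open>f\<close> has
  degree \<open>d \<le> k D\<close>. Moving a point by \<open>G\<close> makes these rows the standard basis; scaling \<open>X\<close> by \<open>t\<close> and
  conjugating by the diagonal matrix with entries \<open>t\<^sup>p\<close> then has a limit for \<open>t \<rightarrow> 0\<close>, in which the
  perturbation of \<open>X\<close> to \<open>X + u A\<^sup>a\<close> (a column times a row) disappears. As \<open>d \<le> k D\<close>, covariance gives
  \<open>f(X + u A\<^sup>a, A) = f(X, A)\<close> for generic and hence for all \<open>(X, A)\<close>.

  The derivative in \<open>u\<close> is \<open>\<Sum>\<^sub>j A\<^sup>a\<^sub>j \<partial>f/\<partial>X\<^sub>i\<^sub>j = 0\<close>. At diagonal \<open>X\<close>, covariance under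
  \<open>1 + s E\<^sub>i\<^sub>j\<close> expresses the off-diagonal derivatives by \<open>\<Sum>\<^sub>b y\<^sup>b\<^sub>i \<partial>/\<partial>y\<^sup>b\<^sub>j\<close>. Applying
  \<open>\<Sum>\<^sub>a \<partial>/\<partial>y\<^sup>a\<^sub>i\<close> and Euler's identity in each column of \<open>y\<close> yields the equation, the constant
  \<open>k + n\<close> being \<open>\<Sum>\<^sub>a \<partial>/\<partial>y\<^sup>a\<^sub>i y\<^sup>a\<^sub>i\<close> on polynomials of degree \<open>k\<close> in column \<open>i\<close>.
\<close>

section \<open>Polynomial functions of a pair of matrices\<close>

type_synonym ('N, 'n) mat_fun = "complex^'N^'N \<Rightarrow> complex^'N^'n \<Rightarrow> complex"

text \<open>Stated inductively, without coefficients, since polynomiality along curves and the chain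
  rule follow by induction over sums and products.\<close>

inductive poly_fun :: "('N::finite, 'n::finite) mat_fun \<Rightarrow> bool" where
  poly_fun_const: "poly_fun (\<lambda>X A. c)"
| poly_fun_X: "poly_fun (\<lambda>X A. X $ i $ j)"
| poly_fun_A: "poly_fun (\<lambda>X A. A $ a $ i)"
| poly_fun_add: "poly_fun F \<Longrightarrow> poly_fun G \<Longrightarrow> poly_fun (\<lambda>X A. F X A + G X A)"
| poly_fun_mult: "poly_fun F \<Longrightarrow> poly_fun G \<Longrightarrow> poly_fun (\<lambda>X A. F X A * G X A)"

lemma poly_fun_sum:
  assumes "\<And>i. i \<in> S \<Longrightarrow> poly_fun (F i)"
  shows "poly_fun (\<lambda>X A. \<Sum>i\<in>S. F i X A)"
  using assms
  by (induction S rule: infinite_finite_induct) (auto intro: poly_fun_const poly_fun_add)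

lemma poly_fun_prod:
  assumes "\<And>i. i \<in> S \<Longrightarrow> poly_fun (F i)"
  shows "poly_fun (\<lambda>X A. \<Prod>i\<in>S. F i X A)"
  using assms
  by (induction S rule: infinite_finite_induct) (auto intro: poly_fun_const poly_fun_mult)

lemma poly_fun_power: "poly_fun F \<Longrightarrow> poly_fun (\<lambda>X A. F X A ^ m)"
  by (induction m) (auto intro: poly_fun_const poly_fun_mult)

lemma poly_fun_poly_value: "poly_fun (poly_value f)"
proof -
  have "poly_fun (\<lambda>X A. entry_value X A v)" for v :: "('N::finite, 'n::finite) entry"
    by (cases v) (auto intro: poly_fun_X poly_fun_A)
  then show ?thesis
    unfolding poly_value_def[abs_def]
    by (intro poly_fun_sum poly_fun_mult poly_fun_const poly_fun_prod poly_fun_power)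
qed

text \<open>Reduces identities known outside a proper zero set to identities of univariate
  polynomials. Both the limit at parameter 0 and the density argument for generic points use it in
  place of topology.\<close>

lemma poly_fun_along_curve:
  assumes "poly_fun F"
    and "\<And>i j. \<exists>p. \<forall>z. X z $ i $ j = poly p z"
    and "\<And>a i. \<exists>p. \<forall>z. A z $ a $ i = poly p z"
  shows "\<exists>p. \<forall>z. F (X z) (A z) = poly p z"
  using assms(1)
proof induction
  case (poly_fun_const c)
  then show ?case by (intro exI[of _ "[:c:]"]) auto
next
  case (poly_fun_add F G)
  then obtain p q where "\<forall>z. F (X z) (A z) = poly p z" "\<forall>z. G (X z) (A z) = poly q z" by blast
  then show ?case by (intro exI[of _ "p + q"]) auto
next
  case (poly_fun_mult F G)
  then obtain p q where "\<forall>z. F (X z) (A z) = poly p z" "\<forall>z. G (X z) (A z) = poly q z" by blast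
  then show ?case by (intro exI[of _ "p * q"]) auto
qed (use assms(2,3) in auto)

section \<open>Partial derivatives and the chain rule for polynomial functions\<close>

definition bump :: "complex^'c^'r \<Rightarrow> 'r::finite \<Rightarrow> 'c::finite \<Rightarrow> complex \<Rightarrow> complex^'c^'r" where
  "bump M p q s = (\<chi> r c. M $ r $ c + (if r = p \<and> c = q then s else 0))"

definition D_X :: "'N::finite \<Rightarrow> 'N \<Rightarrow> ('N, 'n::finite) mat_fun \<Rightarrow> ('N, 'n) mat_fun" where
  "D_X i j F = (\<lambda>X A. deriv (\<lambda>s. F (bump X i j s) A) 0)"

definition D_A :: "'n::finite \<Rightarrow> 'N::finite \<Rightarrow> ('N, 'n) mat_fun \<Rightarrow> ('N, 'n) mat_fun" where
  "D_A a i F = (\<lambda>X A. deriv (\<lambda>s. F X (bump A a i s)) 0)"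

text \<open>The coefficients \<open>P\<close> and \<open>Q\<close> are left arbitrary, so that an
  induction over \<open>F\<close> need not know yet that they are the partial derivatives.\<close>

definition chain_rule ::
  "('N::finite, 'n::finite) mat_fun \<Rightarrow> ('N \<Rightarrow> 'N \<Rightarrow> ('N, 'n) mat_fun) \<Rightarrow>
    ('n \<Rightarrow> 'N \<Rightarrow> ('N, 'n) mat_fun) \<Rightarrow> bool" where
  "chain_rule F P Q \<longleftrightarrow> (\<forall>X A X' A' t.
     (\<forall>i j. ((\<lambda>s. X s $ i $ j) has_field_derivative X' i j) (at t)) \<longrightarrow>
     (\<forall>a i. ((\<lambda>s. A s $ a $ i) has_field_derivative A' a i) (at t)) \<longrightarrow>
     ((\<lambda>s. F (X s) (A s)) has_field_derivative
        ((\<Sum>i\<in>UNIV. \<Sum>j\<in>UNIV. P i j (X t) (A t) * X' i j) +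
         (\<Sum>a\<in>UNIV. \<Sum>i\<in>UNIV. Q a i (X t) (A t) * A' a i))) (at t))"

lemma chain_ruleD:
  assumes "chain_rule F P Q"
    and "\<And>i j. ((\<lambda>s. X s $ i $ j) has_field_derivative X' i j) (at t)"
    and "\<And>a i. ((\<lambda>s. A s $ a $ i) has_field_derivative A' a i) (at t)"
  shows "((\<lambda>s. F (X s) (A s)) has_field_derivative
        ((\<Sum>i\<in>UNIV. \<Sum>j\<in>UNIV. P i j (X t) (A t) * X' i j) +
         (\<Sum>a\<in>UNIV. \<Sum>i\<in>UNIV. Q a i (X t) (A t) * A' a i))) (at t)"
  using assms unfolding chain_rule_def by blast

lemma sum_sum_delta:
  fixes f :: "'a::finite \<Rightarrow> 'b::finite \<Rightarrow> complex"
  shows "(\<Sum>p\<in>UNIV. \<Sum>q\<in>UNIV. f p q * (if p = i \<and> q = j then c else 0)) = f i j * c"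
proof -
  have "(\<Sum>q\<in>UNIV. f p q * (if p = i \<and> q = j then c else 0)) = (if p = i then f i j * c else 0)" for p
    by (cases "p = i") (simp_all add: if_distrib[of "(*) _"] cong: if_cong)
  then show ?thesis by simp
qed

text \<open>The sum and product rules build the coefficients along the structure of \<open>F\<close>
  and keep them polynomial, so derivatives can be iterated.\<close>

lemma chain_rule_exists:
  assumes "poly_fun F"
  shows "\<exists>P Q. (\<forall>i j. poly_fun (P i j)) \<and> (\<forall>a i. poly_fun (Q a i)) \<and> chain_rule F P Q"
  using assms
proof induction
  case (poly_fun_const c)
  show ?case
    by (intro exI[of _ "\<lambda>i j X A. 0"] exI[of _ "\<lambda>a i X A. 0"])
      (auto simp: chain_rule_def intro: poly_fun.poly_fun_const)
next
  case (poly_fun_X i j)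
  have "chain_rule (\<lambda>X (A::complex^'a^'b). X $ i $ j) (\<lambda>p q X A. if p = i \<and> q = j then 1 else 0) (\<lambda>a i X A. 0)"
    unfolding chain_rule_def
    by (auto simp: mult.commute[of "if _ then _ else _"] sum_sum_delta)
  then show ?case
    by (intro exI[of _ "\<lambda>p q X A. if p = i \<and> q = j then 1 else 0"] exI[of _ "\<lambda>a i X A. 0"])
      (auto intro: poly_fun.poly_fun_const)
next
  case (poly_fun_A a i)
  have "chain_rule (\<lambda>X (A::complex^'a^'b). A $ a $ i) (\<lambda>p q X A. 0) (\<lambda>p q X A. if p = a \<and> q = i then 1 else 0)"
    unfolding chain_rule_def
    by (auto simp: mult.commute[of "if _ then _ else _"] sum_sum_delta)
  then show ?case
    by (intro exI[of _ "\<lambda>a i X A. 0"] exI[of _ "\<lambda>p q X A. if p = a \<and> q = i then 1 else 0"])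
      (auto intro: poly_fun.poly_fun_const)
next
  case (poly_fun_add F G)
  then obtain P Q P' Q' where
    pf: "\<forall>i j. poly_fun (P i j)" "\<forall>a i. poly_fun (Q a i)"
      "\<forall>i j. poly_fun (P' i j)" "\<forall>a i. poly_fun (Q' a i)"
    and ch: "chain_rule F P Q" "chain_rule G P' Q'"
    by blast
  have "chain_rule (\<lambda>X A. F X A + G X A) (\<lambda>i j X A. P i j X A + P' i j X A)
      (\<lambda>a i X A. Q a i X A + Q' a i X A)"
    unfolding chain_rule_def
  proof (intro allI impI, goal_cases)
    case (1 X A X' A' t)
    show ?case
      by (rule derivative_eq_intros chain_ruleD[OF ch(1)] chain_ruleD[OF ch(2)] 1[rule_format])+
        (simp add: sum.distrib distrib_right)
  qed
  moreover have "\<forall>i j. poly_fun (\<lambda>X A. P i j X A + P' i j X A)"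
    "\<forall>a i. poly_fun (\<lambda>X A. Q a i X A + Q' a i X A)"
    using pf by (auto intro: poly_fun.poly_fun_add)
  ultimately show ?case by (intro exI conjI)
next
  case (poly_fun_mult F G)
  then obtain P Q P' Q' where
    pf: "\<forall>i j. poly_fun (P i j)" "\<forall>a i. poly_fun (Q a i)"
      "\<forall>i j. poly_fun (P' i j)" "\<forall>a i. poly_fun (Q' a i)"
    and ch: "chain_rule F P Q" "chain_rule G P' Q'"
    by blast
  have "chain_rule (\<lambda>X A. F X A * G X A) (\<lambda>i j X A. P i j X A * G X A + F X A * P' i j X A)
      (\<lambda>a i X A. Q a i X A * G X A + F X A * Q' a i X A)"
    unfolding chain_rule_def
  proof (intro allI impI, goal_cases)
    case (1 X A X' A' t)
    show ?case
      by (rule derivative_eq_intros chain_ruleD[OF ch(1)] chain_ruleD[OF ch(2)] 1[rule_format])+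
        (simp add: sum.distrib sum_distrib_left algebra_simps)
  qed
  moreover have "\<forall>i j. poly_fun (\<lambda>X A. P i j X A * G X A + F X A * P' i j X A)"
    "\<forall>a i. poly_fun (\<lambda>X A. Q a i X A * G X A + F X A * Q' a i X A)"
    by (intro allI poly_fun.poly_fun_add poly_fun.poly_fun_mult pf[rule_format] poly_fun_mult.hyps)+
  ultimately show ?case by (intro exI conjI)
qed

lemma bump_nth [simp]: "bump M p q s $ r $ c = M $ r $ c + (if r = p \<and> c = q then s else 0)"
  by (simp add: bump_def)

lemma bump_0 [simp]: "bump M p q 0 = M"
  by (simp add: vec_eq_iff)

text \<open>Along a coordinate line the chain rule retains a single coefficient, which identifies
  \<open>P\<close> and \<open>Q\<close> with the partial derivatives.\<close>

lemma poly_fun_D: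
  assumes "poly_fun F"
  shows poly_fun_D_X: "poly_fun (D_X i j F)"
    and poly_fun_D_A: "poly_fun (D_A a l F)"
    and chain_rule_D: "chain_rule F (\<lambda>i j. D_X i j F) (\<lambda>a i. D_A a i F)"
proof -
  obtain P Q where PQ: "\<And>i j. poly_fun (P i j)" "\<And>a i. poly_fun (Q a i)" and ch: "chain_rule F P Q"
    using chain_rule_exists[OF assms] by blast
  have b: "((\<lambda>s. bump M p q s $ r $ c) has_field_derivative (if r = p \<and> c = q then 1 else 0)) (at 0)"
    for M :: "complex^'e::finite^'d::finite" and p q r c
    by (auto intro!: derivative_eq_intros)
  have P: "D_X i j F = P i j" for i j
  proof (intro ext)
    fix X A
    have "((\<lambda>s. F (bump X i j s) A) has_field_derivative
        ((\<Sum>p\<in>UNIV. \<Sum>q\<in>UNIV. P p q (bump X i j 0) A * (if p = i \<and> q = j then 1 else 0)) +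
         (\<Sum>a\<in>UNIV. \<Sum>l\<in>UNIV. Q a l (bump X i j 0) A * 0))) (at 0)"
      by (rule chain_ruleD[OF ch, where X = "bump X i j" and A = "\<lambda>_. A"]) (rule b, simp)
    then show "D_X i j F X A = P i j X A"
      unfolding D_X_def sum_sum_delta by (intro DERIV_imp_deriv) simp
  qed
  have Q: "D_A a i F = Q a i" for a i
  proof (intro ext)
    fix X A
    have "((\<lambda>s. F X (bump A a i s)) has_field_derivative
        ((\<Sum>p\<in>UNIV. \<Sum>q\<in>UNIV. P p q X (bump A a i 0) * 0) +
         (\<Sum>p\<in>UNIV. \<Sum>q\<in>UNIV. Q p q X (bump A a i 0) * (if p = a \<and> q = i then 1 else 0)))) (at 0)"
      by (rule chain_ruleD[OF ch, where X = "\<lambda>_. X" and A = "bump A a i"]) (simp, rule b)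
    then show "D_A a i F X A = Q a i X A"
      unfolding D_A_def sum_sum_delta by (intro DERIV_imp_deriv) simp
  qed
  show "poly_fun (D_X i j F)" "poly_fun (D_A a l F)"
    unfolding P Q by (rule PQ)+
  show "chain_rule F (\<lambda>i j. D_X i j F) (\<lambda>a i. D_A a i F)"
    unfolding P Q by (rule ch)
qed

lemma DERIV_poly_fun:
  assumes "poly_fun F"
    and "\<And>i j. ((\<lambda>s. X s $ i $ j) has_field_derivative X' i j) (at t)"
    and "\<And>a i. ((\<lambda>s. A s $ a $ i) has_field_derivative A' a i) (at t)"
  shows "((\<lambda>s. F (X s) (A s)) has_field_derivative
        ((\<Sum>i\<in>UNIV. \<Sum>j\<in>UNIV. D_X i j F (X t) (A t) * X' i j) +
         (\<Sum>a\<in>UNIV. \<Sum>i\<in>UNIV. D_A a i F (X t) (A t) * A' a i))) (at t)"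
  by (rule chain_ruleD[OF chain_rule_D[OF assms(1)] assms(2,3)])

lemma DERIV_bump_A:
  assumes "poly_fun F"
  shows "((\<lambda>s. F X (bump A a i s)) has_field_derivative D_A a i F X A) (at 0)"
proof -
  have "((\<lambda>s. F X (bump A a i s)) has_field_derivative
        ((\<Sum>p\<in>UNIV. \<Sum>q\<in>UNIV. D_X p q F X (bump A a i 0) * 0) +
         (\<Sum>p\<in>UNIV. \<Sum>q\<in>UNIV. D_A p q F X (bump A a i 0) * (if p = a \<and> q = i then 1 else 0)))) (at 0)"
    by (rule DERIV_poly_fun[OF assms, where X = "\<lambda>_. X" and A = "bump A a i"])
      (auto intro!: derivative_eq_intros)
  then show ?thesis unfolding sum_sum_delta by simp
qed

lemma DERIV_bump_X:
  assumes "poly_fun F"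
  shows "((\<lambda>s. F (bump X i j s) A) has_field_derivative D_X i j F X A) (at 0)"
proof -
  have "((\<lambda>s. F (bump X i j s) A) has_field_derivative
        ((\<Sum>p\<in>UNIV. \<Sum>q\<in>UNIV. D_X p q F (bump X i j 0) A * (if p = i \<and> q = j then 1 else 0)) +
         (\<Sum>p\<in>UNIV. \<Sum>q\<in>UNIV. D_A p q F (bump X i j 0) A * 0))) (at 0)"
    by (rule DERIV_poly_fun[OF assms, where X = "bump X i j" and A = "\<lambda>_. A"])
      (auto intro!: derivative_eq_intros)
  then show ?thesis unfolding sum_sum_delta by simp
qed

text \<open>\<open>d_y\<close> overwrites an entry and differentiates at its current value, while
  \<open>D_A\<close> shifts the entry and differentiates at 0. The equation of functions allows
  iteration inside \<open>Omega\<close>.\<close>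

lemma d_y_poly_fun:
  assumes "poly_fun F"
  shows "d_y b i (\<lambda>x y. F (diag x) y) = (\<lambda>x y. D_A b i F (diag x) y)"
proof (intro ext)
  fix x and y :: "complex^'a^'b"
  let ?y = "\<lambda>t::complex. (\<chi> c j. if c = b \<and> j = i then t else y $ c $ j)"
  have y: "?y (y $ b $ i) = y" by (simp add: vec_eq_iff)
  have "((\<lambda>t. F (diag x) (?y t)) has_field_derivative
        ((\<Sum>p\<in>UNIV. \<Sum>q\<in>UNIV. D_X p q F (diag x) (?y (y $ b $ i)) * 0) +
         (\<Sum>p\<in>UNIV. \<Sum>q\<in>UNIV. D_A p q F (diag x) (?y (y $ b $ i)) * (if p = b \<and> q = i then 1 else 0))))
     (at (y $ b $ i))"
    by (rule DERIV_poly_fun[OF assms, where X = "\<lambda>_. diag x" and A = ?y])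
      (auto intro!: derivative_eq_intros)
  then show "d_y b i (\<lambda>x y. F (diag x) y) x y = D_A b i F (diag x) y"
    unfolding sum_sum_delta d_y_def y by (intro DERIV_imp_deriv) simp
qed

text \<open>Varying one coordinate of \<open>x\<close> moves only the entry \<open>(i, i)\<close> of
  \<open>diag x\<close>.\<close>

lemma d_x_poly_fun:
  assumes "poly_fun F"
  shows "d_x i (\<lambda>x y. F (diag x) y) = (\<lambda>x y. D_X i i F (diag x) y)"
proof (intro ext)
  fix x :: "complex^'a" and y
  let ?x = "\<lambda>t::complex. (\<chi> j. if j = i then t else x $ j)"
  have x: "?x (x $ i) = x" by (simp add: vec_eq_iff)
  have D: "((\<lambda>t. diag (?x t) $ p $ q) has_field_derivative (if p = i \<and> q = i then 1 else 0)) (at s)"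
    for p q s
    by (cases "p = q"; cases "p = i") (simp_all add: diag_def)
  have "((\<lambda>t. F (diag (?x t)) y) has_field_derivative
        ((\<Sum>p\<in>UNIV. \<Sum>q\<in>UNIV. D_X p q F (diag (?x (x $ i))) y * (if p = i \<and> q = i then 1 else 0)) +
         (\<Sum>p\<in>UNIV. \<Sum>q\<in>UNIV. D_A p q F (diag (?x (x $ i))) y * 0))) (at (x $ i))"
    by (rule DERIV_poly_fun[OF assms, where X = "\<lambda>t. diag (?x t)" and A = "\<lambda>_. y"])
      (rule D, simp)
  then show "d_x i (\<lambda>x y. F (diag x) y) x y = D_X i i F (diag x) y"
    unfolding sum_sum_delta d_x_def x by (intro DERIV_imp_deriv) simp
qed

section \<open>Homogeneous polynomials in the type of finitely supported functions\<close>

definition monom_value :: "(('N::finite, 'n::finite) entry \<Rightarrow>\<^sub>0 nat) \<Rightarrow> ('N, 'n) mat_fun" where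
  "monom_value m X A = (\<Prod>v\<in>Poly_Mapping.keys m. entry_value X A v ^ Poly_Mapping.lookup m v)"

lemma finite_entry_UNIV: "finite (UNIV :: ('N::finite, 'n::finite) entry set)"
proof -
  have "(UNIV :: ('N, 'n) entry set) =
      range (\<lambda>(i, j). EntryX i j) \<union> range (\<lambda>(a, i). EntryA a i)"
    by (auto simp: image_iff) (metis entry.exhaust)
  then show ?thesis by (metis finite finite_Un finite_imageI)
qed

text \<open>A product over all entries no longer depends on the support of \<open>m\<close>, so
  scaling and multiplication act factor by factor.\<close>

lemma monom_value_UNIV:
  "monom_value m X A = (\<Prod>v\<in>UNIV. entry_value X A v ^ Poly_Mapping.lookup m v)"
  unfolding monom_value_def
  by (rule prod.mono_neutral_left) (auto simp: finite_entry_UNIV in_keys_iff)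

lemma prod_entry_UNIV:
  fixes g :: "('N::finite, 'n::finite) entry \<Rightarrow> complex"
  shows "(\<Prod>v\<in>UNIV. g v) = (\<Prod>i\<in>UNIV. \<Prod>j\<in>UNIV. g (EntryX i j)) * (\<Prod>a\<in>UNIV. \<Prod>i\<in>UNIV. g (EntryA a i))"
proof -
  have U: "(UNIV :: ('N, 'n) entry set) =
      range (\<lambda>(i, j). EntryX i j) \<union> range (\<lambda>(a, i). EntryA a i)"
    by (auto simp: image_iff) (metis entry.exhaust)
  have "(\<Prod>v\<in>UNIV. g v) = prod g (range (\<lambda>(i, j). EntryX i j)) * prod g (range (\<lambda>(a, i). EntryA a i))"
    unfolding U by (rule prod.union_disjoint) auto
  also have "prod g (range (\<lambda>(i, j). EntryX i j)) = (\<Prod>(i, j)\<in>UNIV. g (EntryX i j))"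
    by (subst prod.reindex) (auto simp: inj_on_def case_prod_beta intro!: prod.cong)
  also have "\<dots> = (\<Prod>i\<in>UNIV. \<Prod>j\<in>UNIV. g (EntryX i j))"
    by (simp add: prod.cartesian_product)
  also have "prod g (range (\<lambda>(a, i). EntryA a i)) = (\<Prod>(a, i)\<in>UNIV. g (EntryA a i))"
    by (subst prod.reindex) (auto simp: inj_on_def case_prod_beta intro!: prod.cong)
  also have "\<dots> = (\<Prod>a\<in>UNIV. \<Prod>i\<in>UNIV. g (EntryA a i))"
    by (simp add: prod.cartesian_product)
  finally show ?thesis .
qed

lemma monom_value_scale:
  "monom_value m (\<chi> i j. t * X $ i $ j) A = t ^ monom_deg_X m * monom_value m X A"
  unfolding monom_value_UNIV prod_entry_UNIV monom_deg_X_def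
  by (simp add: power_mult_distrib prod.distrib power_sum)

lemma poly_value_scale:
  assumes "homogeneous_X d f"
  shows "poly_value f (\<chi> i j. t * X $ i $ j) A = t ^ d * poly_value f X A"
  using assms
  unfolding poly_value_def monom_value_def[symmetric] sum_distrib_left homogeneous_X_def
  by (intro sum.cong) (auto simp: monom_value_scale)

lemma poly_value_superset:
  assumes "finite K" "Poly_Mapping.keys f \<subseteq> K"
  shows "poly_value f X A = (\<Sum>m\<in>K. Poly_Mapping.lookup f m * monom_value m X A)"
  unfolding poly_value_def monom_value_def[symmetric]
  by (rule sum.mono_neutral_left) (use assms in \<open>auto simp: in_keys_iff\<close>)

lemma poly_value_add: "poly_value (f + g) X A = poly_value f X A + poly_value g X A"
proof -
  let ?K = "Poly_Mapping.keys f \<union> Poly_Mapping.keys g"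
  have "poly_value h X A = (\<Sum>m\<in>?K. Poly_Mapping.lookup h m * monom_value m X A)"
    if "h \<in> {f, g, f + g}" for h
    using that keys_add[of f g] by (intro poly_value_superset) auto
  then show ?thesis by (simp add: lookup_add distrib_right sum.distrib)
qed

text \<open>The ground state degree is a minimum over elements of \<open>matrix_poly\<close>; this
  predicate serves to exhibit a determinant as such an element of known degree.\<close>

definition hom_fun :: "nat \<Rightarrow> ('N::finite, 'n::finite) mat_fun \<Rightarrow> bool" where
  "hom_fun d F \<longleftrightarrow> (\<exists>f. homogeneous_X d f \<and> (\<forall>X A. poly_value f X A = F X A))"

lemma hom_fun_monom: "monom_deg_X m = d \<Longrightarrow> hom_fun d (\<lambda>X A. c * monom_value m X A)"
  unfolding hom_fun_def
  by (rule exI[of _ "Poly_Mapping.single m c"])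
    (auto simp: homogeneous_X_def poly_value_def monom_value_def[symmetric] split: if_splits)

lemma hom_fun_add: "hom_fun d F \<Longrightarrow> hom_fun d G \<Longrightarrow> hom_fun d (\<lambda>X A. F X A + G X A)"
  unfolding hom_fun_def
proof (elim exE conjE)
  fix f g
  assume "homogeneous_X d f" "homogeneous_X d g"
    "\<forall>X A. poly_value f X A = F X A" "\<forall>X A. poly_value g X A = G X A"
  then show "\<exists>h. homogeneous_X d h \<and> (\<forall>X A. poly_value h X A = F X A + G X A)"
    using Poly_Mapping.keys_add[of f g]
    by (intro exI[of _ "f + g"]) (auto simp: poly_value_add homogeneous_X_def)
qed

lemma hom_fun_0: "hom_fun d (\<lambda>X A. 0)"
  unfolding hom_fun_def by (rule exI[of _ 0]) (simp add: homogeneous_X_def poly_value_def)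

lemma hom_fun_sum:
  assumes "\<And>i. i \<in> S \<Longrightarrow> hom_fun d (F i)"
  shows "hom_fun d (\<lambda>X A. \<Sum>i\<in>S. F i X A)"
  using assms by (induction S rule: infinite_finite_induct) (auto intro: hom_fun_0 hom_fun_add)

lemma monom_value_add: "monom_value (m + m') X A = monom_value m X A * monom_value m' X A"
  unfolding monom_value_UNIV by (simp add: lookup_add power_add prod.distrib)

lemma monom_deg_X_add: "monom_deg_X (m + m') = monom_deg_X m + monom_deg_X m'"
  unfolding monom_deg_X_def by (simp add: lookup_add sum.distrib)

text \<open>The product is expanded into a double sum over pairs of monomials, each of degree
  \<open>d + e\<close>.\<close>

lemma hom_fun_mult:
  assumes "hom_fun d F" "hom_fun e G"
  shows "hom_fun (d + e) (\<lambda>X A. F X A * G X A)"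
proof -
  obtain f g where f: "homogeneous_X d f" "\<And>X A. F X A = poly_value f X A"
    and g: "homogeneous_X e g" "\<And>X A. G X A = poly_value g X A"
    using assms unfolding hom_fun_def by metis
  have "F X A * G X A = (\<Sum>m\<in>Poly_Mapping.keys f. \<Sum>m'\<in>Poly_Mapping.keys g.
      (Poly_Mapping.lookup f m * Poly_Mapping.lookup g m') * monom_value (m + m') X A)" for X A
    unfolding f g poly_value_def monom_value_def[symmetric] sum_product monom_value_add
    by (simp add: mult_ac)
  moreover have "hom_fun (d + e) (\<lambda>X A. \<Sum>m\<in>Poly_Mapping.keys f. \<Sum>m'\<in>Poly_Mapping.keys g.
      (Poly_Mapping.lookup f m * Poly_Mapping.lookup g m') * monom_value (m + m') X A)"
    using f(1) g(1)
    by (intro hom_fun_sum hom_fun_monom) (auto simp: homogeneous_X_def monom_deg_X_add)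
  ultimately show ?thesis by simp
qed

lemma hom_fun_const: "hom_fun 0 (\<lambda>X A. c)"
  using hom_fun_monom[of 0 0 c] by (simp add: monom_value_def monom_deg_X_def)

lemma hom_fun_X: "hom_fun 1 ((\<lambda>X A. X $ i $ j) :: ('N::finite, 'n::finite) mat_fun)"
proof -
  let ?m = "Poly_Mapping.single (EntryX i j :: ('N, 'n) entry) (1::nat)"
  have deg: "monom_deg_X ?m = 1"
    unfolding monom_deg_X_def lookup_single when_def entry.inject
    by (subst sum.cong[OF refl, of _ _ "\<lambda>p. if i = p then 1 else 0"]) auto
  have "1 * monom_value ?m X A = X $ i $ j" for X A
    by (simp add: monom_value_def)
  then show ?thesis using hom_fun_monom[OF deg, of 1] by (simp only:)
qed

lemma hom_fun_A: "hom_fun 0 (\<lambda>X A. A $ a $ i)"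
proof -
  let ?m = "Poly_Mapping.single (EntryA a i) (1::nat)"
  have "monom_deg_X ?m = 0"
    by (simp add: monom_deg_X_def lookup_single)
  moreover have "1 * monom_value ?m X A = A $ a $ i" for X A
    by (simp add: monom_value_def)
  ultimately show ?thesis using hom_fun_monom[of ?m 0 1] by simp
qed

lemma hom_fun_prod:
  assumes "\<And>i. i \<in> S \<Longrightarrow> hom_fun (d i) (F i)"
  shows "hom_fun (\<Sum>i\<in>S. d i) (\<lambda>X A. \<Prod>i\<in>S. F i X A)"
  using assms
  by (induction S rule: infinite_finite_induct) (auto intro: hom_fun_const[of 1] hom_fun_mult)

lemma hom_fun_power: "hom_fun d F \<Longrightarrow> hom_fun (m * d) (\<lambda>X A. F X A ^ m)"
  by (induction m) (auto intro: hom_fun_const[of 1] hom_fun_mult)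

section \<open>Covariant functions\<close>

text \<open>Carrying the inverse as a variable \<open>h\<close> and the determinant on the left
  avoids \<open>matrix_inv\<close> and negative powers.\<close>

definition covariant :: "nat \<Rightarrow> ('N::finite, 'n::finite) mat_fun \<Rightarrow> bool" where
  "covariant k F \<longleftrightarrow> (\<forall>g h X A. g ** h = mat 1 \<longrightarrow> det g ^ k * F (g ** X ** h) (A ** h) = F X A)"

lemma covariantD:
  "covariant k F \<Longrightarrow> g ** h = mat 1 \<Longrightarrow> det g ^ k * F (g ** X ** h) (A ** h) = F X A"
  unfolding covariant_def by blast

lemma matrix_inv_eq:
  fixes g h :: "complex^'N::finite^'N"
  assumes "g ** h = mat 1"
  shows "matrix_inv g = h"
proof -
  have hg: "h ** g = mat 1" using assms matrix_left_right_inverse by blast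
  have "g ** matrix_inv g = mat 1 \<and> matrix_inv g ** g = mat 1"
    unfolding matrix_inv_def by (rule someI[of _ h]) (simp add: assms hg)
  then show ?thesis by (metis assms hg matrix_mul_assoc matrix_mul_lid)
qed

lemma invertible_right_inverse: "g ** h = mat 1 \<Longrightarrow> invertible (g :: complex^'N::finite^'N)"
  unfolding invertible_def using matrix_left_right_inverse by blast

lemma HN_iff_covariant: "f \<in> HN k \<longleftrightarrow> covariant k (poly_value f)"
proof
  assume f: "f \<in> HN k"
  show "covariant k (poly_value f)"
    unfolding covariant_def
  proof (intro allI impI)
    fix g h :: "complex^'a^'a" and X :: "complex^'a^'a" and A :: "complex^'a^'b"
    assume gh: "g ** h = mat 1"
    have inv: "invertible g" using gh by (rule invertible_right_inverse)
    have "poly_value f (g ** X ** h) (A ** h) = det g powi (- int k) * poly_value f X A"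
      using f inv unfolding HN_def matrix_inv_eq[OF gh, symmetric] by blast
    moreover have "det g \<noteq> 0" using inv invertible_det_nz by blast
    ultimately show "det g ^ k * poly_value f (g ** X ** h) (A ** h) = poly_value f X A"
      by (simp add: power_int_minus)
  qed
next
  assume f: "covariant k (poly_value f)"
  show "f \<in> HN k"
    unfolding HN_def
  proof (intro CollectI allI impI)
    fix g :: "complex^'a^'a" and X :: "complex^'a^'a" and A :: "complex^'a^'b"
    assume g: "invertible g"
    then obtain h where gh: "g ** h = mat 1" unfolding invertible_def by blast
    have "det g \<noteq> 0" using g invertible_det_nz by blast
    then show "poly_value f (g ** X ** matrix_inv g) (A ** matrix_inv g) =
        det g powi (- int k) * poly_value f X A"
      using covariantD[OF f gh, of X A]
      by (simp add: power_int_minus field_simps matrix_inv_eq[OF gh])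
  qed
qed

section \<open>Degeneration along a one-parameter group of diagonal matrices\<close>

lemma diag_mult_left: "diag x ** M = (\<chi> i j. x $ i * M $ i $ j)"
  by (simp add: vec_eq_iff matrix_matrix_mult_def diag_def if_distrib[of "\<lambda>z. z * _"] cong: if_cong)

lemma diag_mult_right: "M ** diag x = (\<chi> i j. M $ i $ j * x $ j)"
  by (simp add: vec_eq_iff matrix_matrix_mult_def diag_def if_distrib[of "\<lambda>z. _ * z"] cong: if_cong)

lemma det_diag: "det (diag x) = (\<Prod>i\<in>UNIV. x $ i)"
  by (subst det_diagonal) (simp_all add: diag_def)

text \<open>The point is that \<open>t g\<^sub>t X g\<^sub>t\<^sup>-\<^sup>1\<close> with \<open>g\<^sub>t = diag (t ^ w i)\<close> has a limit for \<open>t \<rightarrow> 0\<close>.\<close>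

lemma covariant_degeneration:
  assumes F: "poly_fun F" "covariant k F"
    and hom: "\<And>t X A. F (\<chi> i j. t * X $ i $ j) A = t ^ d * F X A"
    and le: "d \<le> k * (\<Sum>i\<in>UNIV. w i)"
    and A: "\<And>a v. A $ a $ v \<noteq> 0 \<Longrightarrow> w v = 0"
    and X: "\<And>u v. X $ u $ v \<noteq> 0 \<Longrightarrow> w v \<le> Suc (w u)"
  shows "F X A = 0 ^ (k * (\<Sum>i\<in>UNIV. w i) - d) *
    F (\<chi> u v. if w v = Suc (w u) then X $ u $ v else 0) A"
proof -
  define D where "D = k * (\<Sum>i\<in>UNIV. w i)"
  \<comment> \<open>The matrix \<open>t g X g^-1\<close> with \<open>g = diag (t ^ w i)\<close>,
    written so that it makes sense at \<open>t = 0\<close>. By assumption \<open>X\<close> the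
    natural number subtraction is not truncated where the entry is nonzero.\<close>
  define Y where "Y t = (\<chi> u v. X $ u $ v * t ^ (Suc (w u) - w v))" for t :: complex
  have key: "t ^ (D - d) * F (Y t) A = F X A" if t: "t \<noteq> 0" for t
  proof -
    let ?g = "diag (\<chi> i. t ^ w i)" and ?h = "diag (\<chi> i. inverse (t ^ w i))"
    have gh: "?g ** ?h = mat 1"
      using t by (simp add: diag_mult_left vec_eq_iff) (simp add: diag_def mat_def)
    have Ah: "A ** ?h = A"
      using A by (auto simp: diag_mult_right vec_eq_iff) (metis power_0 inverse_1 mult.right_neutral)
    have "Y t $ u $ v = t * (?g ** X ** ?h) $ u $ v" for u v
    proof (cases "X $ u $ v = 0")
      case False
      then have "t ^ (Suc (w u) - w v) = t * t ^ w u * inverse (t ^ w v)"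
        using X[OF False] t by (simp add: power_diff field_simps)
      then show ?thesis by (simp add: Y_def diag_mult_left diag_mult_right)
    qed (simp add: Y_def diag_mult_left diag_mult_right)
    then have Y: "Y t = (\<chi> u v. t * (?g ** X ** ?h) $ u $ v)" by (simp add: vec_eq_iff)
    have "F (Y t) A = t ^ d * F (?g ** X ** ?h) A"
      unfolding Y by (rule hom)
    moreover have "det ?g ^ k = t ^ D"
      by (simp add: det_diag D_def power_sum[symmetric] power_mult[symmetric] mult.commute)
    ultimately have "t ^ D * F (Y t) A = t ^ d * F X A"
      using covariantD[OF F(2) gh, of X A] by (simp add: Ah)
    moreover have "t ^ D = t ^ d * t ^ (D - d)"
      using le by (simp add: D_def flip: power_add)
    ultimately show ?thesis using t by simp
  qed
  have "\<exists>p. \<forall>z. F (Y z) A = poly p z"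
  proof (rule poly_fun_along_curve[OF F(1)])
    show "\<exists>p. \<forall>z. Y z $ i $ j = poly p z" for i j
      by (rule exI[of _ "monom (X $ i $ j) (Suc (w i) - w j)"]) (simp add: Y_def poly_monom)
    show "\<exists>p. \<forall>z. A $ a $ i = poly p z" for a i
      by (rule exI[of _ "[:A $ a $ i:]"]) simp
  qed
  then obtain p where p: "\<And>z. F (Y z) A = poly p z" by blast
  define q where "q = monom 1 (D - d) * p - [:F X A:]"
  have "poly ([:0, 1:] * q) z = 0" for z
    using key[of z] by (cases "z = 0") (simp_all add: q_def poly_monom p)
  then have "[:0, 1:] * q = 0" using poly_all_0_iff_0 by blast
  then have "q = 0" by simp
  then have "poly q 0 = 0" by simp
  \<comment> \<open>The power of 0 is 1 for \<open>d = D\<close> and 0 for \<open>d < D\<close>,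
    which treats both cases at once.\<close>
  then have "F X A = 0 ^ (D - d) * F (Y 0) A" by (simp add: q_def p poly_monom)
  moreover have "Y 0 = (\<chi> u v. if w v = Suc (w u) then X $ u $ v else 0)"
    using X by (auto simp: Y_def vec_eq_iff power_0_left) (metis le_antisym)
  ultimately show ?thesis by (simp add: D_def)
qed

section \<open>Rank one perturbations of \<open>X\<close>\<close>

definition shear :: "complex^'N::finite^'N \<Rightarrow> complex^'N^'n \<Rightarrow> 'n::finite \<Rightarrow> complex^'N \<Rightarrow> complex^'N^'N" where
  "shear X A a u = (\<chi> r c. X $ r $ c + u $ r * A $ a $ c)"

text \<open>In the added product of a column and a row, \<open>g\<close> acts on the column and
  \<open>h\<close> on the row, and the row of \<open>A\<close> moves to that of
  \<open>A ** h\<close>.\<close>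

lemma shear_conj:
  fixes g h X :: "complex^'N::finite^'N" and A :: "complex^'N^'n::finite"
  shows "g ** shear X A a u ** h = shear (g ** X ** h) (A ** h) a (g *v u)"
proof -
  let ?o = "\<lambda>(u::complex^'N) (v::complex^'N). \<chi> r c. u $ r * v $ c"
  have sh: "shear X A a u = X + ?o u (A $ a)" for X :: "complex^'N^'N" and A :: "complex^'N^'n" and u
    by (simp add: shear_def vec_eq_iff)
  have l: "g ** ?o u v = ?o (g *v u) v" for u v :: "complex^'N"
    by (simp add: vec_eq_iff matrix_matrix_mult_def matrix_vector_mult_def sum_distrib_right mult.assoc)
  have r: "?o u v ** h = ?o u (v v* h)" for u v
    by (simp add: vec_eq_iff matrix_matrix_mult_def vector_matrix_mult_def sum_distrib_left mult.assoc)
  have a: "(A ** h) $ a = A $ a v* h"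
    by (simp add: vec_eq_iff matrix_matrix_mult_def vector_matrix_mult_def)
  have "(B + C) ** h = B ** h + C ** h" for B C :: "complex^'N^'N"
    by (simp add: vec_eq_iff matrix_matrix_mult_def distrib_right sum.distrib)
  then show ?thesis
    unfolding sh a by (simp add: matrix_add_ldistrib l r)
qed

text \<open>The added entries lie in columns of weight 0. They respect the bound on \<open>X\<close>
  and are erased in the degeneration, which keeps only entries with \<open>w v = Suc (w u)\<close>;
  so both sides have the same degeneration.\<close>

lemma shear_invariant_adapted:
  assumes F: "poly_fun F" "covariant k F"
    and hom: "\<And>t X A. F (\<chi> i j. t * X $ i $ j) A = t ^ d * F X A"
    and le: "d \<le> k * (\<Sum>i\<in>UNIV. w i)"
    and A: "\<And>a v. A $ a $ v \<noteq> 0 \<Longrightarrow> w v = 0"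
    and X: "\<And>u v. X $ u $ v \<noteq> 0 \<Longrightarrow> w v \<le> Suc (w u)"
  shows "F (shear X A a u) A = F X A"
proof -
  have X': "w v \<le> Suc (w r)" if "shear X A a u $ r $ v \<noteq> 0" for r v
  proof (cases "X $ r $ v = 0")
    case True
    then have "A $ a $ v \<noteq> 0" using that by (auto simp: shear_def)
    then show ?thesis using A by simp
  qed (rule X)
  have "(\<chi> r v. if w v = Suc (w r) then shear X A a u $ r $ v else 0) =
      (\<chi> r v. if w v = Suc (w r) then X $ r $ v else 0)"
    using A by (auto simp: vec_eq_iff shear_def)
  then show ?thesis
    using covariant_degeneration[OF F hom le A X'] covariant_degeneration[OF F hom le A X]
    by simp
qed

section \<open>Krylov matrices\<close>

text \<open>The row vector \<open>r X^p\<close>.\<close>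

definition krylov_row :: "complex^'N::finite^'N \<Rightarrow> complex^'N \<Rightarrow> nat \<Rightarrow> complex^'N" where
  "krylov_row X r p = ((\<lambda>v. v v* X) ^^ p) r"

lemma krylov_row_0 [simp]: "krylov_row X r 0 = r"
  by (simp add: krylov_row_def)

lemma krylov_row_Suc [simp]: "krylov_row X r (Suc p) = krylov_row X r p v* X"
  by (simp add: krylov_row_def)

text \<open>The product \<open>r h (g X h)^p\<close> telescopes, as \<open>h g = 1\<close>.\<close>

lemma krylov_row_conj:
  assumes "h ** g = mat 1"
  shows "krylov_row (g ** X ** h) (r v* h) p = krylov_row X r p v* h"
proof (induction p)
  case (Suc p)
  have "h ** (g ** X ** h) = X ** h" using assms by (metis matrix_mul_assoc matrix_mul_lid)
  then show ?case by (simp add: Suc vector_matrix_mul_assoc)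
qed simp

lemma hom_fun_krylov_row: "hom_fun p (\<lambda>X A. krylov_row X (A $ a) p $ j)"
proof (induction p arbitrary: j)
  case (Suc p)
  have "hom_fun (p + 1) (\<lambda>X A. \<Sum>i\<in>UNIV. krylov_row X (A $ a) p $ i * X $ i $ j)"
    by (intro hom_fun_sum hom_fun_mult Suc hom_fun_X)
  then show ?case by (simp add: vector_matrix_mult_def)
qed (simp add: hom_fun_A)

lemma hom_fun_imp_poly_fun:
  assumes "hom_fun d F" shows "poly_fun F"
proof -
  obtain f where "\<And>X A. poly_value f X A = F X A" using assms unfolding hom_fun_def by blast
  then have "poly_value f = F" by (intro ext)
  then show ?thesis using poly_fun_poly_value[of f] by simp
qed

lemma row_matrix_mult: "(M ** h) $ v = M $ v v* h"
  by (simp add: vec_eq_iff matrix_matrix_mult_def vector_matrix_mult_def)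

text \<open>Numbering both index sets from 0 lets division of \<open>e v\<close> by \<open>n\<close>
  with remainder encode each \<open>v\<close> as a pair.\<close>

locale labelling =
  fixes e :: "'N::finite \<Rightarrow> nat" and c :: "'n::finite \<Rightarrow> nat"
  assumes e: "bij_betw e UNIV {..<CARD('N)}" and c: "bij_betw c UNIV {..<CARD('n)}"
begin

text \<open>The pairs \<open>(weight v, flavour v)\<close> are the lexicographically first \<open>N\<close> pairs in \<open>\<nat> \<times> {1..n}\<close>.\<close>

definition weight :: "'N \<Rightarrow> nat" where "weight v = e v div CARD('n)"

definition flavour :: "'N \<Rightarrow> 'n" where "flavour v = inv c (e v mod CARD('n))"

text \<open>The matrix \<open>G(X, A)\<close> of the outline. For \<open>n = 1\<close> and diagonal
  \<open>X\<close> its determinant is, up to sign, the Vandermonde determinant times the product of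
  the entries of \<open>A\<close>.\<close>

definition krylov :: "complex^'N^'N \<Rightarrow> complex^'N^'n \<Rightarrow> complex^'N^'N" where
  "krylov X A = (\<chi> v. krylov_row X (A $ flavour v) (weight v))"

lemma c_flavour: "c (flavour v) = e v mod CARD('n)"
proof -
  have "e v mod CARD('n) \<in> range c" using c by (auto simp: bij_betw_def)
  then show ?thesis unfolding flavour_def by (rule f_inv_into_f)
qed

lemma e_less: "e v < CARD('N)"
  using e by (auto simp: bij_betw_def)

lemma c_less: "c a < CARD('n)"
  using c by (auto simp: bij_betw_def)

lemma e_surj: "m < CARD('N) \<Longrightarrow> \<exists>v. e v = m"
  using e by (metis bij_betw_iff_bijections lessThan_iff)

lemma e_eq_iff: "e u = e v \<longleftrightarrow> u = v"
  using e by (auto simp: bij_betw_def inj_on_def)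

lemma c_eq_iff: "c a = c b \<longleftrightarrow> a = b"
  using c by (auto simp: bij_betw_def inj_on_def)

lemma krylov_conj:
  assumes "h ** g = mat 1"
  shows "krylov (g ** X ** h) (A ** h) = krylov X A ** h"
proof -
  have "krylov (g ** X ** h) (A ** h) $ v = (krylov X A ** h) $ v" for v
    unfolding row_matrix_mult by (simp add: krylov_def row_matrix_mult krylov_row_conj[OF assms])
  then show ?thesis by (simp add: vec_eq_iff)
qed

text \<open>Each term of the Leibniz formula takes one entry from every row \<open>v\<close>, of
  degree \<open>weight v\<close>.\<close>

lemma hom_fun_det_krylov: "hom_fun (\<Sum>v\<in>UNIV. weight v) (\<lambda>X A. det (krylov X A))"
proof -
  have "hom_fun (0 + (\<Sum>v\<in>UNIV. weight v)) (\<lambda>X A. \<Sum>p\<in>{p. p permutes UNIV}.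
      of_int (sign p) * (\<Prod>v\<in>UNIV. krylov_row X (A $ flavour v) (weight v) $ p v))"
    by (intro hom_fun_sum hom_fun_mult hom_fun_const hom_fun_prod hom_fun_krylov_row)
  then show ?thesis by (simp add: det_def krylov_def)
qed

text \<open>If \<open>c a < N\<close>, then row \<open>a\<close> of \<open>A\<close> is a weight 0
  row of \<open>krylov X A\<close>, which \<open>h\<close> turns into a standard basis vector.
  Otherwise \<open>N < n\<close> and all weights are 0.\<close>

lemma krylov_mult_inverse_A:
  assumes "krylov X A ** h = mat 1" "(A ** h) $ a $ v \<noteq> 0"
  shows "weight v = 0"
proof (cases "c a < CARD('N)")
  case True
  then obtain u where u: "e u = c a" using e_surj by blast
  have wu: "weight u = 0" "flavour u = a"
    using c_less[of a] c_flavour[of u] by (simp_all add: weight_def u c_eq_iff)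
  have "(A ** h) $ a = (krylov X A ** h) $ u"
    by (simp add: row_matrix_mult krylov_def wu)
  then have "v = u" using assms by (simp add: mat_def split: if_splits)
  then show ?thesis using wu by simp
next
  case False
  then show ?thesis using e_less[of v] c_less[of a] by (simp add: weight_def)
qed

text \<open>Right multiplication by \<open>X\<close> takes the row labelled \<open>e u\<close> to
  the one labelled \<open>e u + n\<close>, which \<open>h\<close> makes a basis vector of weight one
  higher. If that label is not below \<open>N\<close>, no weight exceeds
  \<open>Suc (weight u)\<close>.\<close>

lemma krylov_mult_inverse_X:
  assumes "krylov X A ** h = mat 1" "(krylov X A ** X ** h) $ u $ v \<noteq> 0"
  shows "weight v \<le> Suc (weight u)"
proof (cases "e u + CARD('n) < CARD('N)")
  case True
  then obtain u' where u': "e u' = e u + CARD('n)" using e_surj by blast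
  have w: "weight u' = Suc (weight u)" "c (flavour u') = c (flavour u)"
    by (simp_all add: weight_def u' c_flavour)
  have "(krylov X A ** X ** h) $ u = (krylov X A ** h) $ u'"
    using w by (simp add: row_matrix_mult krylov_def c_eq_iff)
  then have "v = u'" using assms by (simp add: mat_def split: if_splits)
  then show ?thesis using w by simp
next
  case False
  then have "e v div CARD('n) \<le> (e u + CARD('n)) div CARD('n)"
    using e_less[of v] by (intro div_le_mono) simp
  then show ?thesis by (simp add: weight_def)
qed

text \<open>A witness that the determinant is not identically zero: \<open>X\<close> shifts labels
  by \<open>n\<close>, and row \<open>a\<close> of \<open>A\<close> is the basis vector labelled
  \<open>c a\<close>, or 0 if there is none.\<close>

lemma krylov_basepoint:
  "krylov (\<chi> u v. if e v = e u + CARD('n) then 1 else 0) (\<chi> a v. if e v = c a then 1 else 0) = mat 1"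
proof -
  let ?X = "(\<chi> u v. if e v = e u + CARD('n) then 1 else 0) :: complex^'N^'N"
  let ?A = "(\<chi> a v. if e v = c a then 1 else 0) :: complex^'N^'n"
  have row: "krylov_row ?X (?A $ a) p $ v = (if e v = c a + p * CARD('n) then 1 else 0)" for a p v
  proof (induction p arbitrary: v)
    case (Suc p)
    have "krylov_row ?X (?A $ a) (Suc p) $ v =
        (\<Sum>u\<in>UNIV. if e u = c a + p * CARD('n) \<and> e v = e u + CARD('n) then 1 else 0)"
      unfolding krylov_row_Suc vector_matrix_mult_def Suc by (auto intro!: sum.cong)
    also have "\<dots> = (if e v = c a + Suc p * CARD('n) then 1 else 0)"
    proof (cases "e v = c a + Suc p * CARD('n)")
      case True
      then have "c a + p * CARD('n) < CARD('N)" using e_less[of v] by simp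
      then obtain u where u: "e u = c a + p * CARD('n)" using e_surj by blast
      have "e x = c a + p * CARD('n) \<and> e v = e x + CARD('n) \<longleftrightarrow> x = u" for x
        using True by (auto simp: u[symmetric] e_eq_iff)
      then show ?thesis using True by simp
    qed (simp, intro sum.neutral, auto)
    finally show ?case .
  qed simp
  have "krylov ?X ?A $ u $ v = (mat 1 :: complex^'N^'N) $ u $ v" for u v
    unfolding krylov_def
    by (subst vec_lambda_beta, subst row) (simp add: c_flavour weight_def mat_def e_eq_iff)
  then show ?thesis by (simp add: vec_eq_iff)
qed

text \<open>Where the determinant is nonzero, moving by \<open>g = krylov X A\<close> reaches the
  adapted form. The remaining points follow by polynomial identity on a line to the base
  point.\<close>

lemma shear_invariant:
  fixes F :: "('N, 'n) mat_fun"
  assumes F: "poly_fun F" "covariant k F"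
    and hom: "\<And>t X A. F (\<chi> i j. t * X $ i $ j) A = t ^ d * F X A"
    and le: "d \<le> k * (\<Sum>i\<in>UNIV. weight i)"
  shows "F (shear X A a u) A = F X A"
proof -
  have generic: "F (shear X A a u) A = F X A" if "det (krylov X A) \<noteq> 0"
    for X :: "complex^'N^'N" and A :: "complex^'N^'n"
  proof -
    define g where "g = krylov X A"
    have "invertible g" using that unfolding g_def by (simp add: invertible_det_nz)
    then obtain h where gh: "g ** h = mat 1" unfolding invertible_def by blast
    have "F (shear (g ** X ** h) (A ** h) a (g *v u)) (A ** h) = F (g ** X ** h) (A ** h)"
    proof (rule shear_invariant_adapted[OF F hom le])
      show "weight v = 0" if "(A ** h) $ b $ v \<noteq> 0" for b v
        using gh that unfolding g_def by (rule krylov_mult_inverse_A)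
      show "weight v \<le> Suc (weight r)" if "(g ** X ** h) $ r $ v \<noteq> 0" for r v
        using gh that unfolding g_def by (rule krylov_mult_inverse_X)
    qed
    then show ?thesis
      using covariantD[OF F(2) gh, of X A] covariantD[OF F(2) gh, of "shear X A a u" A]
      by (simp add: shear_conj)
  qed
  define X0 :: "complex^'N^'N" where "X0 = (\<chi> u v. if e v = e u + CARD('n) then 1 else 0)"
  define A0 :: "complex^'N^'n" where "A0 = (\<chi> a v. if e v = c a then 1 else 0)"
  \<comment> \<open>The line runs from \<open>(X, A)\<close> at \<open>z = 0\<close> to the base
    point at \<open>z = 1\<close>.\<close>
  define Xz Az where "Xz z = (\<chi> i j. X $ i $ j + z * (X0 $ i $ j - X $ i $ j))"
    and "Az z = (\<chi> a i. A $ a $ i + z * (A0 $ a $ i - A $ a $ i))" for z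
  have pX: "\<exists>p. \<forall>z. Xz z $ i $ j = poly p z" for i j
    by (rule exI[of _ "[:X $ i $ j, X0 $ i $ j - X $ i $ j:]"]) (simp add: Xz_def)
  have pA: "\<exists>p. \<forall>z. Az z $ a $ i = poly p z" for a i
    by (rule exI[of _ "[:A $ a $ i, A0 $ a $ i - A $ a $ i:]"]) (simp add: Az_def)
  have pS: "\<exists>p. \<forall>z. shear (Xz z) (Az z) a u $ i $ j = poly p z" for i j
  proof -
    obtain p where "\<forall>z. Xz z $ i $ j = poly p z" using pX by blast
    moreover obtain q where "\<forall>z. Az z $ a $ j = poly q z" using pA by blast
    ultimately show ?thesis by (intro exI[of _ "p + smult (u $ i) q"]) (simp add: shear_def)
  qed
  obtain p where p: "\<And>z. F (shear (Xz z) (Az z) a u) (Az z) = poly p z"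
    using poly_fun_along_curve[OF F(1) pS pA] by blast
  obtain q where q: "\<And>z. F (Xz z) (Az z) = poly q z"
    using poly_fun_along_curve[OF F(1) pX pA] by blast
  obtain r where r: "\<And>z. det (krylov (Xz z) (Az z)) = poly r z"
    using poly_fun_along_curve[OF hom_fun_imp_poly_fun[OF hom_fun_det_krylov] pX pA] by blast
  \<comment> \<open>Multiplying by the determinant \<open>r\<close> makes the generic identity hold
    for all \<open>z\<close>; \<open>r\<close> cancels because \<open>r(1) = 1\<close>.\<close>
  have "poly ((p - q) * r) z = 0" for z
    using generic[of "Xz z" "Az z"] unfolding p q r by (cases "poly r z = 0") simp_all
  then have "(p - q) * r = 0" using poly_all_0_iff_0 by blast
  moreover have "Xz 1 = X0" "Az 1 = A0" by (simp_all add: Xz_def Az_def vec_eq_iff)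
  then have "poly r 1 = 1" using r[of 1] krylov_basepoint by (simp add: X0_def A0_def)
  then have "r \<noteq> 0" by auto
  ultimately have "p = q" by simp
  moreover have "Xz 0 = X" "Az 0 = A" by (simp_all add: Xz_def Az_def vec_eq_iff)
  ultimately show ?thesis using p[of 0] q[of 0] by simp
qed

text \<open>The power \<open>det (krylov X A) ^ k\<close> is covariant, has this degree and equals 1
  at the base point.\<close>

lemma ground_degree_le:
  "(LEAST d. \<exists>h \<in> (HN k :: ('N, 'n) matrix_poly set). h \<noteq> 0 \<and> homogeneous_X d h)
    \<le> k * (\<Sum>v\<in>UNIV. weight v)"
proof (rule Least_le)
  obtain h :: "('N, 'n) matrix_poly" where h: "homogeneous_X (k * (\<Sum>v\<in>UNIV. weight v)) h"
    "\<And>X A. poly_value h X A = det (krylov X A) ^ k"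
    using hom_fun_power[OF hom_fun_det_krylov, of k] unfolding hom_fun_def by blast
  have "covariant k (poly_value h)"
    unfolding covariant_def h
  proof (intro allI impI)
    fix g g' X :: "complex^'N^'N" and A :: "complex^'N^'n"
    assume gh: "g ** g' = mat 1"
    then have hg: "g' ** g = mat 1" using matrix_left_right_inverse by blast
    have "det g * det g' = 1" using gh by (metis det_I det_mul)
    then have "det g * det (krylov (g ** X ** g') (A ** g')) = det (krylov X A)"
      by (simp add: krylov_conj[OF hg] det_mul mult_ac)
    then show "det g ^ k * det (krylov (g ** X ** g') (A ** g')) ^ k = det (krylov X A) ^ k"
      by (metis power_mult_distrib)
  qed
  then have "h \<in> HN k" by (simp add: HN_iff_covariant)
  moreover have "h \<noteq> 0"
  proof
    assume "h = 0"
    then have "poly_value h X A = 0" for X A by (simp add: poly_value_def)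
    then show False using h(2) krylov_basepoint by (metis det_I power_one zero_neq_one)
  qed
  ultimately show "\<exists>h \<in> (HN k :: ('N, 'n) matrix_poly set).
      h \<noteq> 0 \<and> homogeneous_X (k * (\<Sum>v\<in>UNIV. weight v)) h"
    using h(1) by blast
qed

end

text \<open>Any numbering of the index sets will do, since the conclusion does not involve
  it.\<close>

lemma HN0_shear_invariant:
  fixes f :: "('N::finite, 'n::finite) matrix_poly"
  assumes "f \<in> HN0 k"
  shows "poly_value f (shear X A a u) A = poly_value f X A"
proof -
  obtain e :: "'N \<Rightarrow> nat" where e: "bij_betw e UNIV {..<CARD('N)}"
    using ex_bij_betw_finite_nat[of "UNIV :: 'N set"] by (auto simp: atLeast0LessThan)
  obtain c :: "'n \<Rightarrow> nat" where c: "bij_betw c UNIV {..<CARD('n)}"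
    using ex_bij_betw_finite_nat[of "UNIV :: 'n set"] by (auto simp: atLeast0LessThan)
  interpret labelling e c by unfold_locales (fact e c)+
  from assms have "covariant k (poly_value f)"
    and f: "homogeneous_X (LEAST d. \<exists>h \<in> (HN k :: ('N, 'n) matrix_poly set). h \<noteq> 0 \<and> homogeneous_X d h) f"
    by (simp_all add: HN0_def HN_iff_covariant)
  then show ?thesis
    by (intro shear_invariant[OF poly_fun_poly_value _ poly_value_scale[OF f] ground_degree_le])
qed

section \<open>From shear invariance to the Knizhnik-Zamolodchikov equation\<close>

lemma DERIV_const_eq_0: "((\<lambda>s::complex. c::complex) has_field_derivative D) (at t) \<Longrightarrow> D = 0"
  using DERIV_unique DERIV_const by blast

text \<open>With \<open>u\<close> equal to \<open>s\<close> times the \<open>i\<close>-th basis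
  vector, the shear adds \<open>s\<close> times row \<open>a\<close> of \<open>A\<close> to row
  \<open>i\<close> of \<open>X\<close>; the value is constant in \<open>s\<close>.\<close>

lemma shear_derivative:
  assumes F: "poly_fun F" and shear: "\<And>X A a u. F (shear X A a u) A = F X A"
  shows "(\<Sum>j\<in>UNIV. A $ a $ j * D_X i j F X A) = 0"
proof -
  let ?u = "\<lambda>s::complex. \<chi> r. if r = i then s else 0"
  have "((\<lambda>s. F (shear X A a (?u s)) A) has_field_derivative
        ((\<Sum>p\<in>UNIV. \<Sum>q\<in>UNIV. D_X p q F (shear X A a (?u 0)) A * (if p = i then A $ a $ q else 0)) +
         (\<Sum>p\<in>UNIV. \<Sum>q\<in>UNIV. D_A p q F (shear X A a (?u 0)) A * 0))) (at 0)"
    by (rule DERIV_poly_fun[OF F, where X = "\<lambda>s. shear X A a (?u s)" and A = "\<lambda>_. A"])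
      (auto simp: shear_def cong: if_cong intro!: derivative_eq_intros)
  moreover have "shear X A a (?u 0) = X" by (simp add: vec_eq_iff shear_def)
  ultimately have "(\<Sum>p\<in>UNIV. \<Sum>q\<in>UNIV. D_X p q F X A * (if p = i then A $ a $ q else 0)) = 0"
    unfolding shear by (auto dest: DERIV_const_eq_0)
  moreover have "(\<Sum>q\<in>UNIV. D_X p q F X A * (if p = i then A $ a $ q else 0)) =
      (if p = i then \<Sum>q\<in>UNIV. A $ a $ q * D_X i q F X A else 0)" for p
    by (simp add: mult.commute)
  ultimately show ?thesis by simp
qed

text \<open>Here \<open>bump (mat 1) i j s\<close> serves as the elementary matrix
  \<open>1 + s E_ij\<close>.\<close>

lemma elementary_mult_left:
  fixes M :: "complex^'c::finite^'N::finite"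
  shows "bump (mat 1) i j s ** M = (\<chi> r c. M $ r $ c + (if r = i then s * M $ j $ c else 0))"
proof -
  have "(\<Sum>l\<in>UNIV. ((if r = l then 1 else 0) + (if r = i \<and> l = j then s else 0)) * M $ l $ c) =
      M $ r $ c + (if r = i then s * M $ j $ c else 0)" for r c
    by (cases "r = i") (simp_all add: distrib_right sum.distrib if_distrib[of "\<lambda>z. z * _"] cong: if_cong)
  then show ?thesis by (simp add: vec_eq_iff matrix_matrix_mult_def mat_def)
qed

lemma elementary_mult_right:
  fixes M :: "complex^'N::finite^'r::finite"
  shows "M ** bump (mat 1) i j s = (\<chi> r c. M $ r $ c + (if c = j then s * M $ r $ i else 0))"
proof -
  have "(\<Sum>l\<in>UNIV. M $ r $ l * ((if l = c then 1 else 0) + (if l = i \<and> c = j then s else 0))) =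
      M $ r $ c + (if c = j then s * M $ r $ i else 0)" for r c
    by (cases "c = j") (simp_all add: distrib_left sum.distrib if_distrib[of "\<lambda>z. _ * z"] mult.commute cong: if_cong)
  then show ?thesis by (simp add: vec_eq_iff matrix_matrix_mult_def mat_def)
qed

text \<open>For \<open>i \<noteq> j\<close>, conjugating \<open>diag x\<close> by
  \<open>1 + s E_ij\<close> adds exactly \<open>s (x_j - x_i) E_ij\<close>, while \<open>y\<close>
  loses \<open>s\<close> times column \<open>i\<close> from column \<open>j\<close>. The determinant
  is 1, so \<open>F\<close> is constant in \<open>s\<close>.\<close>

lemma gauge_off_diagonal:
  assumes F: "poly_fun F" "covariant k F" and ij: "i \<noteq> j"
  shows "(x $ j - x $ i) * D_X i j F (diag x) y = (\<Sum>a\<in>UNIV. y $ a $ i * D_A a j F (diag x) y)"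
proof -
  let ?X = "\<lambda>s. bump (diag x) i j (s * (x $ j - x $ i))"
  let ?y = "\<lambda>s. \<chi> a c. y $ a $ c + (if c = j then - s * y $ a $ i else 0)"
  have inv: "F (?X s) (?y s) = F (diag x) y" for s
  proof -
    let ?g = "bump (mat 1) i j s :: complex^'a^'a" and ?h = "bump (mat 1) i j (- s) :: complex^'a^'a"
    have gh: "?g ** ?h = mat 1"
      unfolding elementary_mult_left using ij by (auto simp: vec_eq_iff mat_def)
    have "?g = (\<chi> l. if l = i then row i (mat 1) + s *s row j (mat 1) else row l (mat 1))"
      using ij by (auto simp: vec_eq_iff row_def mat_def)
    then have "det ?g = 1" by (simp add: det_row_operation[OF ij])
    moreover have "?g ** diag x ** ?h = ?X s"
      using ij by (auto simp: elementary_mult_left elementary_mult_right vec_eq_iff diag_def algebra_simps)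
    moreover have "y ** ?h = ?y s"
      by (simp add: elementary_mult_right)
    ultimately show ?thesis using covariantD[OF F(2) gh, of "diag x" y] by simp
  qed
  have "((\<lambda>s. F (?X s) (?y s)) has_field_derivative
        ((\<Sum>p\<in>UNIV. \<Sum>q\<in>UNIV. D_X p q F (?X 0) (?y 0) * (if p = i \<and> q = j then x $ j - x $ i else 0)) +
         (\<Sum>p\<in>UNIV. \<Sum>q\<in>UNIV. D_A p q F (?X 0) (?y 0) * (if q = j then - y $ p $ i else 0)))) (at 0)"
    by (rule DERIV_poly_fun[OF F(1), where X = ?X and A = ?y])
      (auto cong: if_cong intro!: derivative_eq_intros)
  moreover have "?y 0 = y" by (simp add: vec_eq_iff)
  ultimately have "D_X i j F (diag x) y * (x $ j - x $ i) +
      (\<Sum>p\<in>UNIV. \<Sum>q\<in>UNIV. D_A p q F (diag x) y * (if q = j then - y $ p $ i else 0)) = 0"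
    unfolding inv sum_sum_delta by (auto dest: DERIV_const_eq_0)
  moreover have "(\<Sum>q\<in>UNIV. D_A p q F (diag x) y * (if q = j then - y $ p $ i else 0)) =
      - (y $ p $ i * D_A p j F (diag x) y)" for p
    by (simp add: if_distrib[of "\<lambda>z. _ * z"] mult.commute cong: if_cong)
  ultimately show ?thesis by (simp add: sum_negf algebra_simps)
qed

section \<open>Homogeneity of degree \<open>k\<close> in each column of \<open>y\<close>\<close>

definition scale_column :: "'N::finite \<Rightarrow> complex \<Rightarrow> complex^'N^'n \<Rightarrow> complex^'N^'n::finite" where
  "scale_column j c y = (\<chi> b l. if l = j then c * y $ b $ l else y $ b $ l)"

text \<open>A diagonal matrix commutes with \<open>diag x\<close>, so covariance under it rescales
  only a column of \<open>y\<close>.\<close>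

lemma covariant_scale_column:
  assumes F: "covariant k F" and c: "c \<noteq> 0"
  shows "F (diag x) (scale_column j c y) = c ^ k * F (diag x) y"
proof -
  let ?g = "diag (\<chi> i. if i = j then inverse c else 1)" and ?h = "diag (\<chi> i. if i = j then c else 1)"
  have gh: "?g ** ?h = mat 1"
    using c by (simp add: diag_mult_left vec_eq_iff) (simp add: diag_def mat_def)
  have det: "det ?g = inverse c" by (simp add: det_diag)
  have "?g ** diag x ** ?h = diag x"
    using c by (simp add: diag_mult_left diag_mult_right vec_eq_iff) (simp add: diag_def)
  moreover have "y ** ?h = scale_column j c y"
    by (auto simp: diag_mult_right vec_eq_iff scale_column_def mult.commute)
  ultimately have "inverse c ^ k * F (diag x) (scale_column j c y) = F (diag x) y"
    using covariantD[OF F gh, of "diag x" y] by (simp only: det)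
  then show ?thesis using c by (simp add: field_simps power_inverse)
qed

lemma euler_column:
  assumes H: "poly_fun H"
    and scale: "\<And>c. c \<noteq> 0 \<Longrightarrow> H X (scale_column j c y) = c ^ k * H X y"
  shows "(\<Sum>b\<in>UNIV. y $ b $ j * D_A b j H X y) = of_nat k * H X y"
proof -
  \<comment> \<open>The exponential never vanishes, as \<open>scale\<close> requires, and has value
    and derivative 1 at 0.\<close>
  let ?y = "\<lambda>s. scale_column j (exp s) y"
  have "((\<lambda>s. H X (?y s)) has_field_derivative
        ((\<Sum>p\<in>UNIV. \<Sum>q\<in>UNIV. D_X p q H X (?y 0) * 0) +
         (\<Sum>p\<in>UNIV. \<Sum>q\<in>UNIV. D_A p q H X (?y 0) * (if q = j then y $ p $ j else 0)))) (at 0)"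
    by (rule DERIV_poly_fun[OF H, where X = "\<lambda>_. X" and A = ?y])
      (auto simp: scale_column_def cong: if_cong intro!: derivative_eq_intros)
  moreover have "?y 0 = y" by (simp add: scale_column_def vec_eq_iff)
  moreover have "(\<Sum>q\<in>UNIV. D_A p q H X y * (if q = j then y $ p $ j else 0)) =
      y $ p $ j * D_A p j H X y" for p
    by (simp add: if_distrib[of "\<lambda>z. _ * z"] mult.commute cong: if_cong)
  ultimately have "((\<lambda>s. exp s ^ k * H X y) has_field_derivative
      (\<Sum>b\<in>UNIV. y $ b $ j * D_A b j H X y)) (at 0)"
    by (simp add: scale)
  moreover have "((\<lambda>s. exp s ^ k * H X y) has_field_derivative of_nat k * H X y) (at 0)"
    by (auto intro!: derivative_eq_intros)
  ultimately show ?thesis by (rule DERIV_unique)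
qed

text \<open>Bumping a diagonal entry keeps the matrix diagonal, so the scaling law can be
  differentiated in it.\<close>

lemma D_X_scale_column:
  assumes F: "poly_fun F" "covariant k F" and c: "c \<noteq> 0"
  shows "D_X i i F (diag x) (scale_column j c y) = c ^ k * D_X i i F (diag x) y"
proof -
  have "bump (diag x) i i s = diag (\<chi> l. x $ l + (if l = i then s else 0))" for s
    by (auto simp: vec_eq_iff diag_def)
  then have "F (bump (diag x) i i s) (scale_column j c y) = c ^ k * F (bump (diag x) i i s) y" for s
    by (simp add: covariant_scale_column[OF F(2) c])
  then show ?thesis
    using DERIV_bump_X[OF F(1), of "diag x" i i "scale_column j c y"]
      DERIV_cmult[OF DERIV_bump_X[OF F(1), of "diag x" i i y], of "c ^ k"]
    by (simp add: DERIV_unique)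
qed

text \<open>As \<open>i \<noteq> j\<close>, the variable \<open>y $ b $ j\<close> is constant under
  differentiation in column \<open>i\<close>, so all derivatives move to the right. The summation
  indices are then exchanged.\<close>

lemma Omega_poly_fun:
  assumes F: "poly_fun F" and ij: "i \<noteq> j"
  shows "Omega i j (\<lambda>x y. F (diag x) y) x y =
    (\<Sum>a\<in>UNIV. \<Sum>b\<in>UNIV. y $ a $ j * (y $ b $ i * D_A a i (D_A b j F) (diag x) y))"
proof -
  have E: "E_op a b i (E_op b a j (\<lambda>x y. F (diag x) y)) x y =
      y $ a $ i * (y $ b $ j * D_A b i (D_A a j F) (diag x) y)" for a b
  proof -
    let ?G = "\<lambda>X A. A $ b $ j * D_A a j F X A"
    have G: "poly_fun ?G"
      by (intro poly_fun_mult poly_fun_A poly_fun_D_A F)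
    have "E_op b a j (\<lambda>x y. F (diag x) y) = (\<lambda>x y. ?G (diag x) y)"
      by (simp add: E_op_def d_y_poly_fun[OF F])
    then have "E_op a b i (E_op b a j (\<lambda>x y. F (diag x) y)) x y = y $ a $ i * D_A b i ?G (diag x) y"
      using d_y_poly_fun[OF G] by (simp add: E_op_def)
    moreover have "((\<lambda>s. ?G (diag x) (bump y b i s)) has_field_derivative
        y $ b $ j * D_A b i (D_A a j F) (diag x) y) (at 0)"
      using DERIV_cmult[OF DERIV_bump_A[OF poly_fun_D_A[OF F]], of "y $ b $ j"] ij by simp
    ultimately show ?thesis
      using DERIV_unique[OF DERIV_bump_A[OF G]] by simp
  qed
  have "Omega i j (\<lambda>x y. F (diag x) y) x y =
      (\<Sum>b\<in>UNIV. \<Sum>a\<in>UNIV. y $ a $ i * (y $ b $ j * D_A b i (D_A a j F) (diag x) y))"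
    unfolding Omega_def E by (rule sum.swap)
  then show ?thesis by (simp add: mult.left_commute)
qed

theorem theoremD:
  fixes k :: nat and \<phi> :: "('N::finite, 'n::finite) wave"
  assumes "k > 0"
    and "\<phi> \<in> wave_function ` HN0 k"
  shows "\<forall>i. \<forall>x\<in>A_disj. \<forall>y.
    (of_nat k + of_nat CARD('n)) * d_x i \<phi> x y
      - (\<Sum>j\<in>UNIV - {i}. (Omega i j \<phi> x y + of_nat k * \<phi> x y) / (x $ i - x $ j)) = 0"
proof (intro allI ballI)
  fix i :: 'N and x :: "complex^'N" and y :: "complex^'N^'n"
  assume x: "x \<in> A_disj"
  obtain f where f: "f \<in> HN0 k" and \<phi>: "\<phi> = wave_function f" using assms(2) by blast
  define F where "F = poly_value f"
  have \<phi>F: "\<phi> = (\<lambda>x y. F (diag x) y)" by (simp add: \<phi> wave_function_def F_def)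
  have F: "poly_fun F" "covariant k F"
    using f by (simp_all add: F_def poly_fun_poly_value HN0_def HN_iff_covariant)
  have DX: "D_X i j F (diag x) y = (\<Sum>b\<in>UNIV. y $ b $ i * D_A b j F (diag x) y) / (x $ j - x $ i)"
    if "j \<noteq> i" for j y
    using gauge_off_diagonal[OF F, of i j x y] that x by (simp add: A_disj_def field_simps)
  define P where "P = D_X i i F"
  have P: "poly_fun P" unfolding P_def by (rule poly_fun_D_X[OF F(1)])
  \<comment> \<open>The shear identity for row \<open>i\<close>, with off-diagonal derivatives
    eliminated by \<open>DX\<close>. It holds for every \<open>y\<close>, hence may be
    differentiated in \<open>y\<close>.\<close>
  have vanish: "y $ a $ i * P (diag x) y + (\<Sum>j\<in>UNIV - {i}. y $ a $ j *
      ((\<Sum>b\<in>UNIV. y $ b $ i * D_A b j F (diag x) y) / (x $ j - x $ i))) = 0" for a and y :: "complex^'N^'n"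
    using shear_derivative[OF F(1) HN0_shear_invariant[OF f, folded F_def], where X = "diag x" and i = i and a = a and A = y]
    by (subst (asm) sum.remove[of _ i]) (simp_all add: P_def DX)
  \<comment> \<open>The derivative of \<open>vanish\<close> in \<open>y $ a $ i\<close>. The product
    rule contributes the terms \<open>P\<close> and, from \<open>b = a\<close>,
    \<open>D_A a j F\<close>.\<close>
  have deriv: "P (diag x) y + y $ a $ i * D_A a i P (diag x) y + (\<Sum>j\<in>UNIV - {i}. y $ a $ j *
      ((D_A a j F (diag x) y + (\<Sum>b\<in>UNIV. y $ b $ i * D_A a i (D_A b j F) (diag x) y)) / (x $ j - x $ i))) = 0"
    for a
  proof -
    let ?y = "bump y a i"
    have n: "((\<lambda>s. ?y s $ b $ i * G (diag x) (?y s)) has_field_derivative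
        (if b = a then 1 else 0) * G (diag x) y + y $ b $ i * D_A a i G (diag x) y) (at 0)"
      if "poly_fun G" for b G
      using DERIV_bump_A[OF that, of "diag x" y a i]
      by (auto intro!: derivative_eq_intros)
    have "?y s $ a $ j = y $ a $ j" if "j \<in> UNIV - {i}" for s j
      using that by simp
    then have "((\<lambda>s. ?y s $ a $ i * P (diag x) (?y s) + (\<Sum>j\<in>UNIV - {i}. ?y s $ a $ j *
        ((\<Sum>b\<in>UNIV. ?y s $ b $ i * D_A b j F (diag x) (?y s)) / (x $ j - x $ i))))
      has_field_derivative
      ((if a = a then 1 else 0) * P (diag x) y + y $ a $ i * D_A a i P (diag x) y + (\<Sum>j\<in>UNIV - {i}. y $ a $ j *
      ((\<Sum>b\<in>UNIV. (if b = a then 1 else 0) * D_A b j F (diag x) y + y $ b $ i * D_A a i (D_A b j F) (diag x) y) / (x $ j - x $ i)))))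
      (at 0)"
      by (simp only: cong: sum.cong)
        (intro DERIV_add DERIV_sum DERIV_cmult DERIV_cdivide n P poly_fun_D_A F)
    moreover have "(\<Sum>b\<in>UNIV. (if b = a then 1 else 0) * D_A b j F (diag x) y + y $ b $ i * D_A a i (D_A b j F) (diag x) y) =
        D_A a j F (diag x) y + (\<Sum>b\<in>UNIV. y $ b $ i * D_A a i (D_A b j F) (diag x) y)" for j
      by (simp add: sum.distrib if_distrib[of "\<lambda>z. z * _"] cong: if_cong)
    ultimately show ?thesis
      unfolding vanish by (intro DERIV_const_eq_0) (simp only: simp_thms if_True mult_1)
  qed
  have euler: "(\<Sum>a\<in>UNIV. y $ a $ i * D_A a i P (diag x) y) = of_nat k * P (diag x) y"
    by (rule euler_column[OF P]) (simp add: P_def D_X_scale_column[OF F])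
  have "(\<Sum>b\<in>UNIV. y $ b $ j * D_A b j F (diag x) y) = of_nat k * F (diag x) y" for j
    by (rule euler_column[OF F(1) covariant_scale_column[OF F(2)]])
  \<comment> \<open>Euler's identity in column \<open>j\<close> turns the first-order terms into
    \<open>k\<close> times the wave function; the second-order terms form
    \<open>Omega\<close>.\<close>
  then have Omega: "(\<Sum>a\<in>UNIV. y $ a $ j * (D_A a j F (diag x) y + (\<Sum>b\<in>UNIV. y $ b $ i * D_A a i (D_A b j F) (diag x) y))) =
      Omega i j \<phi> x y + of_nat k * \<phi> x y"
    if "j \<noteq> i" for j
    using that
    by (simp add: \<phi>F Omega_poly_fun[OF F(1)] distrib_left sum.distrib sum_distrib_left)
  let ?S = "\<lambda>a j. D_A a j F (diag x) y + (\<Sum>b\<in>UNIV. y $ b $ i * D_A a i (D_A b j F) (diag x) y)"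
  \<comment> \<open>Summing \<open>deriv\<close> over \<open>a\<close> gives \<open>n\<close> copies
    of \<open>P\<close>, and \<open>euler\<close> adds \<open>k\<close> more.\<close>
  have "0 = (\<Sum>a\<in>UNIV. P (diag x) y + y $ a $ i * D_A a i P (diag x) y +
      (\<Sum>j\<in>UNIV - {i}. y $ a $ j * (?S a j / (x $ j - x $ i))))"
    by (simp only: deriv sum.neutral_const)
  also have "\<dots> = of_nat CARD('n) * P (diag x) y + of_nat k * P (diag x) y +
      (\<Sum>j\<in>UNIV - {i}. \<Sum>a\<in>UNIV. y $ a $ j * (?S a j / (x $ j - x $ i)))"
    unfolding sum.distrib euler by (subst sum.swap) simp
  also have "(\<Sum>j\<in>UNIV - {i}. \<Sum>a\<in>UNIV. y $ a $ j * (?S a j / (x $ j - x $ i))) =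
      (\<Sum>j\<in>UNIV - {i}. - ((Omega i j \<phi> x y + of_nat k * \<phi> x y) / (x $ i - x $ j)))"
  proof (rule sum.cong[OF refl])
    fix j assume "j \<in> UNIV - {i}"
    then have "(\<Sum>a\<in>UNIV. y $ a $ j * (?S a j / (x $ j - x $ i))) =
        (Omega i j \<phi> x y + of_nat k * \<phi> x y) / (x $ j - x $ i)"
      using Omega[of j] by (simp only: times_divide_eq_right sum_divide_distrib[symmetric]) simp
    then show "(\<Sum>a\<in>UNIV. y $ a $ j * (?S a j / (x $ j - x $ i))) =
        - ((Omega i j \<phi> x y + of_nat k * \<phi> x y) / (x $ i - x $ j))"
      by (metis minus_diff_eq minus_divide_right)
  qed
  finally show "(of_nat k + of_nat CARD('n)) * d_x i \<phi> x y
      - (\<Sum>j\<in>UNIV - {i}. (Omega i j \<phi> x y + of_nat k * \<phi> x y) / (x $ i - x $ j)) = 0"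
    by (simp add: \<phi>F d_x_poly_fun[OF F(1)] P_def sum_negf algebra_simps)
qed

end
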